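(* Let $v(\overline{OPF}_{\phi,\gamma'})$ be the optimal value of the quadratic convex relaxation $(\overline{OPF}_{\phi,\gamma'})$, and let $(P)$ be the problem $$(P):\quad \max\Big\{ v(\overline{OPF}_{\phi,\gamma'}) \;:\; \phi\in\mathbb{R}^{2n},\ \gamma\in\mathbb{R}^{n},\ \gamma'=(\gamma,\gamma),\ \sum_{r\in\mathcal{C}}\phi_r A_r+\mathrm{d}(\gamma')\succeq 0\Big\}.$$ Then the optimal value of $(P)$ equals the optimal value of the rank relaxation $(SDP)$. (Both problems, and all data, are as defined in the context.)
   Context: **Data.** An electric network is a graph $(\mathcal{N},\mathcal{E})$ with $\mathcal{N}=\{1,\dots,n\}$ partitioned as $\mathcal{N}=\mathcal{N}_g\cup\mathcal{N}_d$ (generator nodes and consuming nodes); $\delta(i)$ is the set of nodes adjacent to $i$. The complex admittance matrix has entries $\mathbf{R}_{i,k}+\mathrm{j}\,\mathbf{I}_{i,k}$ for each line $(i,k)$, where $\mathrm{j}^2=-1$, and $\mathbf{R}_{i,i}=\mathbf{r}_{i,i}-\sum_{k\ne i}\mathbf{R}_{i,k}$, $\mathbf{I}_{i,i}=\mathbf{i}_{i,i}-\sum_{k\neq i}\mathbf{I}_{i,k}$ with given real shunt conductances $\mathbf{r}_{i,i}$ and susceptances $\mathbf{i}_{i,i}$. Also given are real loads $\mathbf{p}_i,\mathbf{q}_i$ ($i\in\mathcal{N}$), bounds $\underline{\mathbf{v}}_i,\overline{\mathbf{v}}_i$ ($i\in\mathcal{N}$, with $\overline{\mathbf{v}}_i\ge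 0$), bounds $\underline{\mathbf{p}}_i,\overline{\mathbf{p}}_i,\underline{\mathbf{q}}_i,\overline{\mathbf{q}}_i$ ($i\in\mathcal{N}_g$), a diagonal positive semidefinite matrix $\mathbf{C}$ of order $|\mathcal{N}_g|$, and $\mathbf{c}\in\mathbb{R}^{|\mathcal{N}_g|}$. **Variables.** $x=(e,f)\in\mathbb{R}^{2n}$ (so $x_i=e_i$, $x_{i+n}=f_i$), $y=(p,q)\in\mathbb{R}^{2|\mathcal{N}_g|}$, $z=(z^e,z^f)\in\mathbb{R}^{2n}$ (so $z_i=z^e_i$, $z_{i+n}=z^f_i$). **Power balance equations.** For $i\in\mathcal{N}$ put $$F_i(e,f)=\mathbf{R}_{i,i}(e_i^2+f_i^2)+\sum_{k\in\delta(i)}\big[\mathbf{R}_{i,k}(e_ie_k+f_if_k)-\mathbf{I}_{i,k}(e_if_k-e_kf_i)\big],$$ $$G_i(e,f)=-\mathbf{I}_{i,i}(e_i^2+f_i^2)+\sum_{k\in\delta(i)}\big[-\mathbf{I}_{i,k}(e_ie_k+f_if_k)-\mathbf{R}_{i,k}(e_if_k-e_kf_i)\big].$$ The $2n$ power balance equations of the OPF problem are: $p_i-F_i(e,f)=\mathbf{p}_i$ and $q_i-G_i(e,f)=\mathbf{q}_i$ for $i\in\mathcal{N}_g$; $-F_i(e,f)=\mathbf{p}_i$ and $-G_i(e,f)=\mathbf{q}_i$ for $i\in\mathcal{N}_d$. They are indexed by a set $\mathcal{C}$ with $|\mathcal{C}|=2n$ and written $$\langle A_r,xx^T\rangle+a_r^Ty=b_r,\qquad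 r\in\mathcal{C},$$ where $A_r$ is the real symmetric $2n\times 2n$ matrix of the quadratic form in $x$ on the left-hand side of equation $r$, $a_r\in\mathbb{R}^{2|\mathcal{N}_g|}$ is the vector of coefficients of $y$, $b_r$ is the right-hand side, and $\langle M,N\rangle=\mathrm{tr}(M^TN)$. Let $\lambda_r=\lambda_{\min}(A_r)$ and $\lambda'_r=\lambda_{\min}(-A_r)$ (smallest eigenvalues). For a vector $w$, $\mathrm{d}(w)$ is the diagonal matrix with diagonal $w$. **Convex relaxation.** For $\phi\in\mathbb{R}^{2n}$ (indexed by $\mathcal{C}$), $\gamma\in\mathbb{R}^n$ and $\gamma'=(\gamma,\gamma)\in\mathbb{R}^{2n}$, let $$h_{\phi,\gamma'}(x,y,z)=\sum_{i\in\mathcal{N}_g}\big(\mathbf{C}_{i,i}p_i^2+\mathbf{c}_ip_i\big)+\Big\langle\sum_{r\in\mathcal{C}}\phi_rA_r+\mathrm{d}(\gamma'),xx^T\Big\rangle+\sum_{r\in\mathcal{C}}\phi_r(a_r^Ty-b_r)-\gamma'^Tz.$$ With $u=(\sqrt{\overline{\mathbf{v}}},\sqrt{\overline{\mathbf{v}}})\in\mathbb{R}^{2n}$ (componentwise square roots) and $\ell=-u$, problem $(\overline{OPF}_{\phi,\gamma'})$ is: minimize $h_{\phi,\gamma'}(x,y,z)$ over $(x,y,z)\in\mathbb{R}^{2n}\times\mathbb{R}^{2|\mathcal{N}_g|}\times\mathbb{R}^{2n}$ subject to - $\underline{\mathbf{p}}_i\le p_i\le\overline{\mathbf{p}}_i$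 and $\underline{\mathbf{q}}_i\le q_i\le\overline{\mathbf{q}}_i$ for $i\in\mathcal{N}_g$; - $\underline{\mathbf{v}}_i\le z_i+z_{i+n}\le\overline{\mathbf{v}}_i$ for $i\in\mathcal{N}$; - $\langle A_r,xx^T\rangle+a_r^Ty-\lambda_r\sum_{i=1}^{2n}(x_i^2-z_i)\le b_r$ for $r\in\mathcal{C}$; - $\langle -A_r,xx^T\rangle-a_r^Ty-\lambda'_r\sum_{i=1}^{2n}(x_i^2-z_i)\le -b_r$ for $r\in\mathcal{C}$; - $z_i\le(u_i+\ell_i)x_i-u_i\ell_i$ and $z_i\ge x_i^2$ for $i=1,\dots,2n$. **Rank relaxation $(SDP)$.** Minimize $\sum_{i\in\mathcal{N}_g}(\mathbf{C}_{i,i}Y_{i,i}+\mathbf{c}_ip_i)$ over $y=(p,q)\in\mathbb{R}^{2|\mathcal{N}_g|}$, symmetric $Y$ of order $2|\mathcal{N}_g|$ (with $Y_{i,i}$, $i\in\mathcal{N}_g$, the diagonal entry corresponding to $p_i$), and symmetric $X$ of order $2n$, subject to - $\langle A_r,X\rangle+a_r^Ty=b_r$ for $r\in\mathcal{C}$; - $\underline{\mathbf{v}}_i\le X_{i,i}+X_{i+n,i+n}\le\overline{\mathbf{v}}_i$ for $i\in\mathcal{N}$; - $\underline{\mathbf{p}}_i\le p_i\le\overline{\mathbf{p}}_i$ and $\underline{\mathbf{q}}_i\le q_i\le\overline{\mathbf{q}}_i$ for $i\in\mathcal{N}_g$; - $\begin{bmatrix}1&y^T\\ y&Y\end{bmatrix}\succeq0$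 and $X\succeq0$. Optimal values are understood in the extended reals as the infimum (minimization) or supremum (maximization) over the feasible set. *)

theory Defs
  imports "HOL-Analysis.Analysis"
begin

definition sym_matrix :: "real^'k^'k \<Rightarrow> bool" where
  "sym_matrix M \<longleftrightarrow> transpose M = M"

definition psd :: "real^'k^'k \<Rightarrow> bool" where
  "psd M \<longleftrightarrow> sym_matrix M \<and> (\<forall>v. 0 \<le> v \<bullet> (M *v v))"

definition eigenval :: "real^'k^'k \<Rightarrow> real \<Rightarrow> bool" where
  "eigenval M l \<longleftrightarrow> (\<exists>v. v \<noteq> 0 \<and> M *v v = l *\<^sub>R v)"

definition lambda_min :: "real^'k^'k \<Rightarrow> real" where
  "lambda_min M = (LEAST l. eigenval M l)"

definition frob :: "real^'k^'k \<Rightarrow> real^'k^'k \<Rightarrow> real" where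
  "frob M N = trace (transpose M ** N)"

definition outer :: "real^'k \<Rightarrow> real^'k^'k" where
  "outer x = (\<chi> s t. x $ s * x $ t)"

definition diag :: "real^'k \<Rightarrow> real^'k^'k" where
  "diag w = (\<chi> s t. if s = t then w $ s else 0)"

text \<open>The block matrix with rows (1, y^T) and (y, Y); the index None is the border.\<close>

definition bordered :: "real^'k \<Rightarrow> real^'k^'k \<Rightarrow> real^('k option)^('k option)" where
  "bordered y Y = (\<chi> s t. case s of
       None \<Rightarrow> (case t of None \<Rightarrow> 1 | Some k \<Rightarrow> y $ k)
     | Some j \<Rightarrow> (case t of None \<Rightarrow> y $ j | Some k \<Rightarrow> Y $ j $ k))"

text \<open>The symmetric matrix of a quadratic form q. By \<open>sym_matrix_of_qform\<close>, \<open>is_qform_Fbal\<close> and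
  \<open>is_qform_Gbal\<close> below, the description is proper for all the forms it is applied to, and
  \<open>balance_equations\<close> shows that the resulting matrices give back the power balance equations.\<close>

definition sym_matrix_of :: "(real^'k \<Rightarrow> real) \<Rightarrow> real^'k^'k" where
  "sym_matrix_of q = (THE M. sym_matrix M \<and> (\<forall>x. q x = frob M (outer x)))"

definition dup :: "real^'n \<Rightarrow> real^('n + 'n)" where
  "dup w = (\<chi> s. case s of Inl i \<Rightarrow> w $ i | Inr i \<Rightarrow> w $ i)"

text \<open>The node set is the finite type \<^typ>\<open>'n\<close>, so n is \<open>CARD('n)\<close>. Index sets of size 2n are
  rendered by the type \<^typ>\<open>'n + 'n\<close>: for x = (e,f), \<open>Inl i\<close> selects e and \<open>Inr i\<close> selects f,
  and similarly for y = (p,q) and z; the power balance equations are indexed by \<open>Inl i\<close> (active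
  power at node i) and \<open>Inr i\<close> (reactive power at node i).

  The set of generator nodes \<open>gens\<close> may be any subset of the nodes, and the consuming nodes are its
  complement. Vectors and matrices indexed by generators are elements of the coordinate subspace
  whose entries vanish at all other indices; a matrix in this subspace (bordered or not) is
  positive semidefinite iff its submatrix on the generator indices is. The entries of \<open>plo\<close>, \<open>pup\<close>,
  \<open>qlo\<close>, \<open>qup\<close> and \<open>ccost\<close> at nodes outside \<open>gens\<close> are never used.

  \<open>cond\<close> and \<open>susc\<close> are the real and imaginary parts of the full admittance matrix, with zero
  entries for pairs of distinct nodes that are not joined by a line. They need not be symmetric.\<close>

record ('n::finite) opf_data =
  gens :: "'n set"
  adj :: "'n \<Rightarrow> 'n \<Rightarrow> bool"
  cond :: "real^'n^'n"
  susc :: "real^'n^'n"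
  shunt_cond :: "real^'n"
  shunt_susc :: "real^'n"
  pload :: "real^'n"
  qload :: "real^'n"
  vlo :: "real^'n"
  vup :: "real^'n"
  plo :: "real^'n"
  pup :: "real^'n"
  qlo :: "real^'n"
  qup :: "real^'n"
  Ccost :: "real^'n^'n"
  ccost :: "real^'n"

definition opf_network :: "('n::finite) opf_data \<Rightarrow> bool" where
  "opf_network D \<longleftrightarrow>
     (\<forall>i. \<not> adj D i i) \<and> (\<forall>i k. adj D i k \<longrightarrow> adj D k i) \<and>
     (\<forall>i k. i \<noteq> k \<and> \<not> adj D i k \<longrightarrow> cond D $ i $ k = 0 \<and> susc D $ i $ k = 0) \<and>
     (\<forall>i. cond D $ i $ i = shunt_cond D $ i - (\<Sum>k\<in>UNIV - {i}. cond D $ i $ k)) \<and>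
     (\<forall>i. susc D $ i $ i = shunt_susc D $ i - (\<Sum>k\<in>UNIV - {i}. susc D $ i $ k)) \<and>
     (\<forall>i. 0 \<le> vup D $ i) \<and>
     (\<forall>i k. \<not> (i = k \<and> i \<in> gens D) \<longrightarrow> Ccost D $ i $ k = 0) \<and> psd (Ccost D)"

definition nbrs :: "('n::finite) opf_data \<Rightarrow> 'n \<Rightarrow> 'n set" where
  "nbrs D i = {k. adj D i k}"

definition gen_vec :: "('n::finite) opf_data \<Rightarrow> real^('n + 'n) \<Rightarrow> bool" where
  "gen_vec D y \<longleftrightarrow> (\<forall>s. s \<notin> gens D <+> gens D \<longrightarrow> y $ s = 0)"

definition gen_mat :: "('n::finite) opf_data \<Rightarrow> real^('n + 'n)^('n + 'n) \<Rightarrow> bool" where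
  "gen_mat D Y \<longleftrightarrow>
     (\<forall>s t. \<not> (s \<in> gens D <+> gens D \<and> t \<in> gens D <+> gens D) \<longrightarrow> Y $ s $ t = 0)"

definition Fbal :: "('n::finite) opf_data \<Rightarrow> 'n \<Rightarrow> real^('n + 'n) \<Rightarrow> real" where
  "Fbal D i x = (let e = (\<lambda>k. x $ Inl k); f = (\<lambda>k. x $ Inr k); R = cond D; B = susc D in
     R $ i $ i * ((e i)\<^sup>2 + (f i)\<^sup>2)
     + (\<Sum>k\<in>nbrs D i. R $ i $ k * (e i * e k + f i * f k) - B $ i $ k * (e i * f k - e k * f i)))"

definition Gbal :: "('n::finite) opf_data \<Rightarrow> 'n \<Rightarrow> real^('n + 'n) \<Rightarrow> real" where
  "Gbal D i x = (let e = (\<lambda>k. x $ Inl k); f = (\<lambda>k. x $ Inr k); R = cond D; B = susc D in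
     - (B $ i $ i) * ((e i)\<^sup>2 + (f i)\<^sup>2)
     + (\<Sum>k\<in>nbrs D i. - (B $ i $ k) * (e i * e k + f i * f k) - R $ i $ k * (e i * f k - e k * f i)))"

definition Amat :: "('n::finite) opf_data \<Rightarrow> 'n + 'n \<Rightarrow> real^('n + 'n)^('n + 'n)" where
  "Amat D r = sym_matrix_of (\<lambda>x. case r of Inl i \<Rightarrow> - Fbal D i x | Inr i \<Rightarrow> - Gbal D i x)"

definition avec :: "('n::finite) opf_data \<Rightarrow> 'n + 'n \<Rightarrow> real^('n + 'n)" where
  "avec D r = (if r \<in> gens D <+> gens D then axis r 1 else 0)"

definition bval :: "('n::finite) opf_data \<Rightarrow> 'n + 'n \<Rightarrow> real" where
  "bval D r = (case r of Inl i \<Rightarrow> pload D $ i | Inr i \<Rightarrow> qload D $ i)"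

definition gen_bounds :: "('n::finite) opf_data \<Rightarrow> real^('n + 'n) \<Rightarrow> bool" where
  "gen_bounds D y \<longleftrightarrow> (\<forall>i\<in>gens D.
     plo D $ i \<le> y $ Inl i \<and> y $ Inl i \<le> pup D $ i \<and>
     qlo D $ i \<le> y $ Inr i \<and> y $ Inr i \<le> qup D $ i)"

definition Lmat :: "('n::finite) opf_data \<Rightarrow> real^('n + 'n) \<Rightarrow> real^('n + 'n) \<Rightarrow>
    real^('n + 'n)^('n + 'n)" where
  "Lmat D \<phi> \<gamma>' = (\<Sum>r\<in>UNIV. \<phi> $ r *\<^sub>R Amat D r) + diag \<gamma>'"

definition hobj :: "('n::finite) opf_data \<Rightarrow> real^('n + 'n) \<Rightarrow> real^('n + 'n) \<Rightarrow>
    real^('n + 'n) \<Rightarrow> real^('n + 'n) \<Rightarrow> real^('n + 'n) \<Rightarrow> real" where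
  "hobj D \<phi> \<gamma>' x y z =
     (\<Sum>i\<in>gens D. Ccost D $ i $ i * (y $ Inl i)\<^sup>2 + ccost D $ i * y $ Inl i)
     + frob (Lmat D \<phi> \<gamma>') (outer x)
     + (\<Sum>r\<in>UNIV. \<phi> $ r * (avec D r \<bullet> y - bval D r))
     - \<gamma>' \<bullet> z"

definition ubound :: "('n::finite) opf_data \<Rightarrow> real^('n + 'n)" where
  "ubound D = dup (\<chi> i. sqrt (vup D $ i))"

definition lbound :: "('n::finite) opf_data \<Rightarrow> real^('n + 'n)" where
  "lbound D = - ubound D"

definition OPF_feasible :: "('n::finite) opf_data \<Rightarrow>
    ((real^('n + 'n)) \<times> (real^('n + 'n)) \<times> (real^('n + 'n))) set" where
  "OPF_feasible D = {(x, y, z).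
     gen_vec D y \<and> gen_bounds D y \<and>
     (\<forall>i. vlo D $ i \<le> z $ Inl i + z $ Inr i \<and> z $ Inl i + z $ Inr i \<le> vup D $ i) \<and>
     (\<forall>r. frob (Amat D r) (outer x) + avec D r \<bullet> y
            - lambda_min (Amat D r) * (\<Sum>s\<in>UNIV. (x $ s)\<^sup>2 - z $ s) \<le> bval D r) \<and>
     (\<forall>r. frob (- Amat D r) (outer x) - avec D r \<bullet> y
            - lambda_min (- Amat D r) * (\<Sum>s\<in>UNIV. (x $ s)\<^sup>2 - z $ s) \<le> - bval D r) \<and>
     (\<forall>s. z $ s \<le> (ubound D $ s + lbound D $ s) * x $ s - ubound D $ s * lbound D $ s \<and>
          z $ s \<ge> (x $ s)\<^sup>2)}"

definition OPF_value :: "('n::finite) opf_data \<Rightarrow> real^('n + 'n) \<Rightarrow> real^('n + 'n) \<Rightarrow> ereal" where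
  "OPF_value D \<phi> \<gamma>' = (INF (x, y, z)\<in>OPF_feasible D. ereal (hobj D \<phi> \<gamma>' x y z))"

text \<open>The maximum over the multipliers is a supremum in the extended reals; it need not be
  attained.\<close>

definition P_value :: "('n::finite) opf_data \<Rightarrow> ereal" where
  "P_value D = (SUP (\<phi>, \<gamma>)\<in>{(\<phi>, \<gamma>). psd (Lmat D \<phi> (dup \<gamma>))}. OPF_value D \<phi> (dup \<gamma>))"

definition SDP_feasible :: "('n::finite) opf_data \<Rightarrow>
    ((real^('n + 'n)) \<times> (real^('n + 'n)^('n + 'n)) \<times> (real^('n + 'n)^('n + 'n))) set" where
  "SDP_feasible D = {(y, Y, X).
     gen_vec D y \<and> gen_mat D Y \<and> sym_matrix Y \<and> sym_matrix X \<and>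
     (\<forall>r. frob (Amat D r) X + avec D r \<bullet> y = bval D r) \<and>
     (\<forall>i. vlo D $ i \<le> X $ Inl i $ Inl i + X $ Inr i $ Inr i \<and>
          X $ Inl i $ Inl i + X $ Inr i $ Inr i \<le> vup D $ i) \<and>
     gen_bounds D y \<and> psd (bordered y Y) \<and> psd X}"

definition SDP_value :: "('n::finite) opf_data \<Rightarrow> ereal" where
  "SDP_value D = (INF (y, Y, X)\<in>SDP_feasible D.
     ereal (\<Sum>i\<in>gens D. Ccost D $ i $ i * Y $ Inl i $ Inl i + ccost D $ i * y $ Inl i))"

lemma frob_eq: "frob M N = (\<Sum>s\<in>UNIV. \<Sum>t\<in>UNIV. M $ s $ t * N $ s $ t)"
  unfolding frob_def trace_def transpose_def matrix_matrix_mult_def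
  by (simp, rule sum.swap)

lemma frob_outer: "frob M (outer x) = x \<bullet> (M *v x)"
  by (simp add: frob_eq outer_def inner_vec_def matrix_vector_mult_def sum_distrib_left mult_ac)

lemma frob_add: "frob (M + N) Z = frob M Z + frob N Z"
  by (simp add: frob_eq algebra_simps sum.distrib)

lemma frob_scale: "frob (c *\<^sub>R M) Z = c * frob M Z"
  by (simp add: frob_eq sum_distrib_left mult_ac)

definition is_qform :: "(real^'k \<Rightarrow> real) \<Rightarrow> bool" where
  "is_qform q \<longleftrightarrow> (\<exists>M. sym_matrix M \<and> (\<forall>x. q x = frob M (outer x)))"

lemma sym_matrix_entry: "sym_matrix M \<longleftrightarrow> (\<forall>s t. M $ s $ t = M $ t $ s)"
  by (auto simp: sym_matrix_def transpose_def vec_eq_iff)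

lemma is_qform_zero: "is_qform (\<lambda>x. 0)"
  unfolding is_qform_def by (rule exI[of _ 0]) (simp add: sym_matrix_entry frob_eq)

lemma is_qform_add: "is_qform p \<Longrightarrow> is_qform q \<Longrightarrow> is_qform (\<lambda>x. p x + q x)"
  unfolding is_qform_def
proof (elim exE conjE)
  fix M N assume "sym_matrix M" "\<forall>x. p x = frob M (outer x)"
    "sym_matrix N" "\<forall>x. q x = frob N (outer x)"
  then show "\<exists>K. sym_matrix K \<and> (\<forall>x. p x + q x = frob K (outer x))"
    by (intro exI[of _ "M + N"]) (simp add: sym_matrix_entry frob_add)
qed

lemma is_qform_scale: "is_qform p \<Longrightarrow> is_qform (\<lambda>x. c * p x)"
  unfolding is_qform_def
proof (elim exE conjE)
  fix M assume "sym_matrix M" "\<forall>x. p x = frob M (outer x)"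
  then show "\<exists>K. sym_matrix K \<and> (\<forall>x. c * p x = frob K (outer x))"
    by (intro exI[of _ "c *\<^sub>R M"]) (simp add: sym_matrix_entry frob_scale)
qed

lemma is_qform_minus: "is_qform p \<Longrightarrow> is_qform (\<lambda>x. - p x)"
  using is_qform_scale[of p "-1"] by simp

lemma is_qform_diff: "is_qform p \<Longrightarrow> is_qform q \<Longrightarrow> is_qform (\<lambda>x. p x - q x)"
  using is_qform_add[OF _ is_qform_minus] by fastforce

lemma is_qform_sum: "(\<And>k. k \<in> K \<Longrightarrow> is_qform (q k)) \<Longrightarrow> is_qform (\<lambda>x. \<Sum>k\<in>K. q k x)"
  by (induction K rule: infinite_finite_induct) (auto intro: is_qform_zero is_qform_add)

lemma is_qform_coord:
  fixes a b :: "'k::finite"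
  shows "is_qform (\<lambda>x. x $ a * x $ b)"
proof -
  let ?M = "\<chi> s t. (of_bool (s = a \<and> t = b) + of_bool (s = b \<and> t = a)) / (2 :: real)"
  have "x $ a * x $ b = frob ?M (outer x)" for x :: "real^'k"
  proof -
    have *: "(\<Sum>s\<in>UNIV. \<Sum>t\<in>UNIV. of_bool (s = c \<and> t = d) * (x $ s * x $ t)) = x $ c * x $ d"
      for c d
    proof -
      have "(\<Sum>t\<in>UNIV. of_bool (s = c \<and> t = d) * (x $ s * x $ t)) =
          (if s = c then x $ s * x $ d else 0)" for s
      proof (cases "s = c")
        case True
        have "(\<Sum>t\<in>UNIV. of_bool (s = c \<and> t = d) * (x $ s * x $ t)) =
            (\<Sum>t\<in>UNIV. if t = d then x $ s * x $ t else 0)"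
          using True by (intro sum.cong) auto
        then show ?thesis using True by simp
      qed auto
      then show ?thesis by simp
    qed
    have "frob ?M (outer x) =
        ((\<Sum>s\<in>UNIV. \<Sum>t\<in>UNIV. of_bool (s = a \<and> t = b) * (x $ s * x $ t)) +
         (\<Sum>s\<in>UNIV. \<Sum>t\<in>UNIV. of_bool (s = b \<and> t = a) * (x $ s * x $ t))) / 2"
      by (simp add: frob_eq outer_def add_divide_distrib distrib_right sum.distrib sum_divide_distrib
          del: sum_of_bool_mult_eq sum_mult_of_bool_eq)
    then show ?thesis by (simp only: *) simp
  qed
  moreover have "sym_matrix ?M" unfolding sym_matrix_entry by (simp add: conj_commute add.commute)
  ultimately show ?thesis unfolding is_qform_def by (intro exI[of _ ?M] conjI allI)
qed

lemma is_qform_sq: "is_qform (\<lambda>x. (x $ a)\<^sup>2)"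
  using is_qform_coord[of a a] by (simp add: power2_eq_square)

lemma sym_matrix_unique:
  assumes "sym_matrix M" "sym_matrix N" "\<And>x. frob M (outer x) = frob N (outer x)"
  shows "M = N"
proof -
  have polar: "(axis s 1 + axis t 1) \<bullet> (K *v (axis s 1 + axis t 1)) =
      K $ s $ s + K $ t $ t + 2 * K $ s $ t" if "sym_matrix K" for K :: "real^'k^'k" and s t
  proof -
    have "K $ t $ s = K $ s $ t" using that by (simp add: sym_matrix_entry)
    then show ?thesis
      by (simp add: matrix_vector_right_distrib inner_add_left inner_add_right
          matrix_vector_mul_component inner_axis' inner_axis)
  qed
  have d: "axis s 1 \<bullet> (K *v axis s 1) = K $ s $ s" for K :: "real^'k^'k" and s
    by (simp add: matrix_vector_mul_component inner_axis' inner_axis)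
  have eq: "x \<bullet> (M *v x) = x \<bullet> (N *v x)" for x using assms(3) by (simp add: frob_outer)
  have "M $ s $ s = N $ s $ s" for s using eq[of "axis s 1"] by (simp add: d)
  moreover have "M $ s $ s + M $ t $ t + 2 * M $ s $ t = N $ s $ s + N $ t $ t + 2 * N $ s $ t" for s t
    using eq[of "axis s 1 + axis t 1"] by (simp only: polar assms)
  ultimately show ?thesis by (simp add: vec_eq_iff)
qed

lemma sym_matrix_of_qform:
  assumes "is_qform q"
  shows "sym_matrix (sym_matrix_of q)" and "frob (sym_matrix_of q) (outer x) = q x"
proof -
  have "\<exists>!M. sym_matrix M \<and> (\<forall>x. q x = frob M (outer x))"
  proof -
    obtain M where M: "sym_matrix M" "\<And>x. q x = frob M (outer x)"
      using assms is_qform_def by metis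
    show ?thesis
    proof (rule ex1I[of _ M])
      show "sym_matrix M \<and> (\<forall>x. q x = frob M (outer x))" using M by simp
      show "N = M" if "sym_matrix N \<and> (\<forall>x. q x = frob N (outer x))" for N
        using sym_matrix_unique[of N M] that M by metis
    qed
  qed
  note * = theI'[OF this, folded sym_matrix_of_def]
  show "sym_matrix (sym_matrix_of q)" using * by (rule conjunct1)
  show "frob (sym_matrix_of q) (outer x) = q x" using * by metis
qed

lemma is_qform_Fbal: "is_qform (Fbal D i)"
  unfolding Fbal_def[abs_def] Let_def
  by (intro is_qform_add is_qform_diff is_qform_scale is_qform_sum is_qform_coord is_qform_sq)

lemma is_qform_Gbal: "is_qform (Gbal D i)"
  unfolding Gbal_def[abs_def] Let_def
  by (intro is_qform_add is_qform_diff is_qform_scale is_qform_sum is_qform_coord is_qform_sq)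

lemma sym_matrix_Amat: "sym_matrix (Amat D r)"
  unfolding Amat_def
  by (cases r) (auto intro!: sym_matrix_of_qform is_qform_minus is_qform_Fbal is_qform_Gbal)

lemma frob_Amat_Inl: "frob (Amat D (Inl i)) (outer x) = - Fbal D i x"
  using sym_matrix_of_qform(2)[OF is_qform_minus[OF is_qform_Fbal]] by (simp add: Amat_def)

lemma frob_Amat_Inr: "frob (Amat D (Inr i)) (outer x) = - Gbal D i x"
  using sym_matrix_of_qform(2)[OF is_qform_minus[OF is_qform_Gbal]] by (simp add: Amat_def)

lemma balance_equations:
  "(\<forall>r. frob (Amat D r) (outer x) + avec D r \<bullet> y = bval D r) \<longleftrightarrow>
   (\<forall>i\<in>gens D. y $ Inl i - Fbal D i x = pload D $ i \<and> y $ Inr i - Gbal D i x = qload D $ i) \<and>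
   (\<forall>i\<in>- gens D. - Fbal D i x = pload D $ i \<and> - Gbal D i x = qload D $ i)"
proof -
  have *: "(\<forall>r. P r) \<longleftrightarrow> (\<forall>i\<in>gens D. P (Inl i) \<and> P (Inr i)) \<and> (\<forall>i\<in>- gens D. P (Inl i) \<and> P (Inr i))"
    for P
  proof
    assume R: "(\<forall>i\<in>gens D. P (Inl i) \<and> P (Inr i)) \<and> (\<forall>i\<in>- gens D. P (Inl i) \<and> P (Inr i))"
    show "\<forall>r. P r"
    proof
      fix r show "P r" using R by (cases r) blast+
    qed
  qed auto
  show ?thesis
    unfolding * by (auto simp: frob_Amat_Inl frob_Amat_Inr avec_def bval_def inner_axis' add_ac)
qed

end

theory Submission
  imports Defs
begin

text \<open>Both values are tied to one conic program. Its variables are the generation \<open>y\<close> in its box, the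
  squared voltage magnitudes \<open>w\<close> in theirs, and a matrix \<open>X\<close> in the cone of positive semidefinite
  matrices. The cost \<open>gen_cost D y\<close> is minimized subject to the balance equations, which are linear in
  \<open>(y, X)\<close>, and to \<open>X\<^sub>i\<^sub>,\<^sub>i + X\<^sub>i\<^sub>+\<^sub>n\<^sub>,\<^sub>i\<^sub>+\<^sub>n = w\<^sub>i\<close>. This is the rank relaxation: for a given \<open>y\<close> the
  cheapest matrix \<open>Y\<close> is \<open>outer y\<close>. The vectors \<open>\<phi>\<close> and \<open>\<gamma>\<close> are Lagrange multipliers of the two groups
  of equations. The Lagrangian depends on \<open>X\<close> through \<open>frob (Lmat D \<phi> (dup \<gamma>)) X\<close>, which is bounded
  below on the cone iff \<open>Lmat D \<phi> (dup \<gamma>)\<close> is positive semidefinite; its minimum is then 0. So the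
  constraint of the outer maximization is dual feasibility.

  The outer maximum is at most the value of the rank relaxation (\<open>P_value_le_SDP_value\<close>): from a
  feasible \<open>(y, Y, X)\<close> one passes to the point with \<open>x = 0\<close>, the same \<open>y\<close>, and the diagonal of \<open>X\<close> as \<open>z\<close>.
  It satisfies the quadratic constraints because \<open>A - \<lambda>\<^sub>m\<^sub>i\<^sub>n(A) I\<close> is positive semidefinite, so that its
  trace product with \<open>X\<close> is nonnegative, and its objective differs from the cost by \<open>-\<langle>L, X\<rangle> \<le> 0\<close>, where
  \<open>L\<close> is \<open>Lmat D \<phi> (dup \<gamma>)\<close>.

  Conversely (\<open>SDP_value_le_P_value\<close>), for a positive semidefinite \<open>L\<close> the term in \<open>x\<close> of the objective
  is nonnegative, and \<open>z\<close> enters the rest only through its sums over pairs of coordinates, which respect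
  the voltage bounds. So the value of the convex relaxation is at least the Lagrangian dual function.
  There is no gap between the conic program and its dual (\<open>conic_strong_duality\<close>), because \<open>y\<close> and \<open>w\<close>
  range over compact boxes and \<open>w\<close> determines the trace of \<open>X\<close>, so that the set of attainable costs and
  residuals is closed. The same argument covers an infeasible rank relaxation, where both values are
  \<open>\<infinity>\<close>.\<close>

section \<open>Positive semidefinite matrices\<close>

lemma inner_mult_sym:
  assumes "sym_matrix M"
  shows "v \<bullet> (M *v w) = w \<bullet> (M *v v)"
  using assms dot_lmul_matrix[of v M w]
  by (simp add: sym_matrix_def inner_commute flip: transpose_matrix_vector)

lemma psd_cauchy_schwarz:
  assumes "psd M"
  shows "(v \<bullet> (M *v w))\<^sup>2 \<le> (v \<bullet> (M *v v)) * (w \<bullet> (M *v w))"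
proof -
  let ?a = "v \<bullet> (M *v v)" and ?b = "v \<bullet> (M *v w)" and ?c = "w \<bullet> (M *v w)"
  have quad: "0 \<le> ?a + 2 * t * ?b + t\<^sup>2 * ?c" for t
  proof -
    have "0 \<le> (v + t *\<^sub>R w) \<bullet> (M *v (v + t *\<^sub>R w))"
      using assms by (simp add: psd_def)
    also have "\<dots> = ?a + 2 * t * ?b + t\<^sup>2 * ?c"
      using assms inner_mult_sym[of M w v]
      by (simp add: psd_def matrix_vector_right_distrib matrix_vector_mult_scaleR
          inner_add_left inner_add_right power2_eq_square algebra_simps)
    finally show ?thesis .
  qed
  show ?thesis
  proof (cases "?c = 0")
    case True
    have "?b = 0"
    proof (rule ccontr)
      assume "?b \<noteq> 0"
      then show False
        using quad[of "- (?a + 1) / (2 * ?b)"] True by (simp add: field_simps)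
    qed
    then show ?thesis using True by simp
  next
    case False
    then have c: "?c > 0" using assms by (metis psd_def less_eq_real_def)
    then show ?thesis
      using quad[of "- ?b / ?c"] by (simp add: field_simps power2_eq_square)
  qed
qed

lemma psd_kernel:
  assumes "psd M" "v \<bullet> (M *v v) = 0"
  shows "M *v v = 0"
  using psd_cauchy_schwarz[OF assms(1), of "M *v v" v] assms(2) by simp

lemma inner_axis_mult: "axis s 1 \<bullet> (M *v axis t 1) = (M $ s $ t :: real)"
  by (simp add: matrix_vector_mul_component inner_axis' inner_axis)

lemma psd_diag_nonneg: "psd M \<Longrightarrow> 0 \<le> M $ s $ s"
  using inner_axis_mult[of s M s] by (metis psd_def)

lemma psd_entry_square_le: "psd M \<Longrightarrow> (M $ s $ t)\<^sup>2 \<le> M $ s $ s * M $ t $ t"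
  using psd_cauchy_schwarz[of M "axis s 1" "axis t 1"] by (simp add: inner_axis_mult)

lemma outer_mult: "outer x *v v = (x \<bullet> v) *\<^sub>R x"
  by (auto simp: vec_eq_iff outer_def matrix_vector_mult_def inner_vec_def sum_distrib_left mult_ac)

lemma psd_outer: "psd (outer x)"
  unfolding psd_def
proof (intro conjI allI)
  show "sym_matrix (outer x)" by (simp add: sym_matrix_entry outer_def mult.commute)
  show "0 \<le> v \<bullet> (outer x *v v)" for v
    by (simp add: outer_mult inner_commute)
qed

lemma psd_add: "psd M \<Longrightarrow> psd N \<Longrightarrow> psd (M + N)"
  by (auto simp: psd_def sym_matrix_entry matrix_vector_mult_add_rdistrib inner_add_right)

lemma psd_scale: "psd M \<Longrightarrow> 0 \<le> c \<Longrightarrow> psd (c *\<^sub>R M)"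
  by (auto simp: psd_def sym_matrix_entry simp flip: scaleR_matrix_vector_assoc)

lemma psd_zero: "psd 0"
  by (simp add: psd_def sym_matrix_entry)

text \<open>One step of the Cholesky elimination: subtracting the rank one matrix built from a column with
  nonzero pivot keeps positive semidefiniteness, which is the Cauchy--Schwarz inequality.\<close>

lemma psd_eliminate_pivot:
  assumes "psd X" "X $ k $ k \<noteq> 0"
  shows "psd (X - (1 / X $ k $ k) *\<^sub>R outer (X $ k))"
  unfolding psd_def
proof (intro conjI allI)
  show "sym_matrix (X - (1 / X $ k $ k) *\<^sub>R outer (X $ k))"
    using assms(1) by (simp add: psd_def sym_matrix_entry outer_def mult.commute)
  fix v
  have pos: "X $ k $ k > 0" using assms psd_diag_nonneg[of X k] by linarith
  have "(axis k 1 \<bullet> (X *v v))\<^sup>2 \<le> X $ k $ k * (v \<bullet> (X *v v))"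
    using psd_cauchy_schwarz[OF assms(1), of "axis k 1" v] by (simp add: inner_axis_mult)
  then have "(X $ k \<bullet> v)\<^sup>2 \<le> X $ k $ k * (v \<bullet> (X *v v))"
    by (simp add: inner_axis' matrix_vector_mul_component)
  then show "0 \<le> v \<bullet> ((X - (1 / X $ k $ k) *\<^sub>R outer (X $ k)) *v v)"
    using pos
    by (simp add: matrix_vector_mult_diff_rdistrib inner_diff_right outer_mult
        power2_eq_square field_simps inner_commute flip: scaleR_matrix_vector_assoc)
qed

lemma frob_commute: "frob M N = frob N M"
  by (simp add: frob_eq mult.commute)

lemma linear_frob: "linear (frob M)"
  by (rule linearI) (metis frob_commute frob_add, metis frob_commute frob_scale real_scaleR_def)

text \<open>The cone of positive semidefinite matrices is contained in its dual. Eliminating one pivot of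
  \<open>X\<close> after the other writes \<open>X\<close> as a sum of rank one matrices \<open>outer v\<close>, and on those the trace
  product with \<open>M\<close> is the quadratic form of \<open>M\<close>.\<close>

lemma frob_psd_nonneg:
  assumes "psd M" "psd X"
  shows "0 \<le> frob M X"
  using assms(2)
proof (induction "card {k. X $ k $ k \<noteq> 0}" arbitrary: X rule: less_induct)
  case less
  show ?case
  proof (cases "\<exists>k. X $ k $ k \<noteq> 0")
    case False
    then have "(X $ s $ t)\<^sup>2 \<le> 0" for s t
      using psd_entry_square_le[OF less.prems, of s t] by simp
    then show ?thesis by (simp add: frob_eq)
  next
    case True
    then obtain k where k: "X $ k $ k \<noteq> 0" by blast
    define X' where "X' = X - (1 / X $ k $ k) *\<^sub>R outer (X $ k)"
    have X': "psd X'" unfolding X'_def by (rule psd_eliminate_pivot[OF less.prems k])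
    have "X' $ s $ s = 0" if "X $ s $ s = 0" for s
    proof -
      have "(X $ k $ s)\<^sup>2 \<le> 0"
        using psd_entry_square_le[OF less.prems, of k s] that by simp
      then show ?thesis using that by (simp add: X'_def outer_def)
    qed
    moreover have "X' $ k $ k = 0" using k by (simp add: X'_def outer_def)
    ultimately have "{s. X' $ s $ s \<noteq> 0} \<subset> {s. X $ s $ s \<noteq> 0}" using k by blast
    then have "0 \<le> frob M X'"
      by (intro less.hyps X' psubset_card_mono) auto
    moreover have "0 \<le> (1 / X $ k $ k) * frob M (outer (X $ k))"
      using assms(1) psd_diag_nonneg[OF less.prems] by (simp add: frob_outer psd_def)
    moreover have "frob M X = frob M X' + (1 / X $ k $ k) * frob M (outer (X $ k))"
      by (simp add: X'_def linear_diff[OF linear_frob] linear_cmul[OF linear_frob])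
    ultimately show ?thesis by linarith
  qed
qed

lemma closed_psd: "closed {X :: real^'k^'k. psd X}"
proof -
  have "{X :: real^'k^'k. psd X} =
      (\<Inter>s. \<Inter>t. {X. X $ s $ t = X $ t $ s}) \<inter> (\<Inter>v. {X. 0 \<le> v \<bullet> (X *v v)})"
    by (auto simp: psd_def sym_matrix_entry)
  moreover have "closed {X :: real^'k^'k. X $ s $ t = X $ t $ s}" for s t
    by (intro closed_Collect_eq continuous_intros)
  moreover have "closed {X :: real^'k^'k. 0 \<le> v \<bullet> (X *v v)}" for v
    unfolding matrix_vector_mult_def inner_vec_def
    by (intro closed_Collect_le continuous_intros)
  ultimately show ?thesis by (simp add: closed_INT closed_Int)
qed

lemma convex_psd: "convex {X :: real^'k^'k. psd X}"
  by (auto simp: convex_def intro: psd_add psd_scale)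

lemma conic_psd: "conic {X :: real^'k^'k. psd X}"
  by (auto simp: conic_def intro: psd_scale)

text \<open>The least eigenvalue is the minimum \<open>m\<close> of the Rayleigh quotient: that minimum makes
  \<open>M - m I\<close> positive semidefinite, and a minimiser lies in the kernel of \<open>M - m I\<close>.\<close>

lemma psd_shift_lambda_min:
  fixes M :: "real^'k^'k"
  assumes "sym_matrix M"
  shows "psd (M - lambda_min M *\<^sub>R mat 1)"
proof -
  let ?q = "\<lambda>v. v \<bullet> (M *v v)"
  have "continuous_on (sphere 0 1) ?q"
    by (intro continuous_on_inner continuous_on_id matrix_vector_mult_linear_continuous_on)
  moreover have "sphere (0 :: real^'k) 1 \<noteq> {}" by simp
  ultimately have "\<exists>u\<in>sphere 0 1. \<forall>v\<in>sphere 0 1. ?q u \<le> ?q v"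
    by (intro continuous_attains_inf compact_sphere)
  then obtain u where u: "u \<in> sphere 0 1" and min: "\<And>v. v \<in> sphere 0 1 \<Longrightarrow> ?q u \<le> ?q v"
    by blast
  define m where "m = ?q u"
  have le: "m * (v \<bullet> v) \<le> ?q v" for v
  proof (cases "v = 0")
    case False
    have "m \<le> ?q ((1 / norm v) *\<^sub>R v)"
      unfolding m_def by (rule min) (use False in simp)
    also have "\<dots> = ?q v / (norm v)\<^sup>2"
      by (simp add: matrix_vector_mult_scaleR power2_eq_square)
    finally show ?thesis using False by (simp add: field_simps power2_norm_eq_inner)
  qed simp
  have psd: "psd (M - m *\<^sub>R mat 1)"
    unfolding psd_def
  proof (intro conjI allI)
    show "sym_matrix (M - m *\<^sub>R mat 1)" using assms by (simp add: sym_matrix_entry mat_def)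
    show "0 \<le> v \<bullet> ((M - m *\<^sub>R mat 1) *v v)" for v
      using le[of v] by (simp add: matrix_vector_mult_diff_rdistrib inner_diff_right
          flip: scaleR_matrix_vector_assoc)
  qed
  have "u \<bullet> ((M - m *\<^sub>R mat 1) *v u) = 0"
    using u by (simp add: matrix_vector_mult_diff_rdistrib inner_diff_right m_def dot_square_norm
        flip: scaleR_matrix_vector_assoc)
  then have "(M - m *\<^sub>R mat 1) *v u = 0" by (rule psd_kernel[OF psd])
  then have "M *v u = m *\<^sub>R u"
    by (simp add: matrix_vector_mult_diff_rdistrib flip: scaleR_matrix_vector_assoc)
  then have "eigenval M m" using u unfolding eigenval_def by (intro exI[of _ u]) auto
  moreover have "m \<le> l" if l: "eigenval M l" for l
  proof -
    obtain v where v: "v \<noteq> 0" "M *v v = l *\<^sub>R v" using l unfolding eigenval_def by blast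
    then show ?thesis using le[of v] by simp
  qed
  ultimately have "lambda_min M = m" unfolding lambda_min_def by (rule Least_equality)
  then show ?thesis using psd by simp
qed

lemma lambda_min_trace_le:
  assumes "sym_matrix M" "psd X"
  shows "lambda_min M * (\<Sum>s\<in>UNIV. X $ s $ s) \<le> frob M X"
proof -
  have "frob (mat 1) X = (\<Sum>s\<in>UNIV. X $ s $ s)"
    by (simp add: frob_def trace_def transpose_mat)
  moreover have "0 \<le> frob (M - lambda_min M *\<^sub>R mat 1) X"
    by (rule frob_psd_nonneg[OF psd_shift_lambda_min[OF assms(1)] assms(2)])
  moreover have "frob (M - lambda_min M *\<^sub>R mat 1) X = frob M X - lambda_min M * frob (mat 1) X"
    by (simp add: frob_commute[of _ X] linear_diff[OF linear_frob] linear_cmul[OF linear_frob])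
  ultimately show ?thesis by simp
qed

section \<open>Conic duality over a compact set\<close>

text \<open>The image of a closed cone is generated by the compact image of its unit vectors, and that image
  avoids the origin.\<close>

lemma closed_linear_image_cone:
  fixes T :: "'b::euclidean_space \<Rightarrow> 'c::euclidean_space"
  assumes "closed N" "conic N" "0 \<in> N" "linear T"
    and ker: "\<And>X. X \<in> N \<Longrightarrow> T X = 0 \<Longrightarrow> X = 0"
  shows "closed (T ` N)"
proof -
  let ?B = "T ` (N \<inter> sphere 0 1)"
  have "compact ?B"
    using assms by (intro compact_continuous_image closed_Int_compact compact_sphere
        linear_continuous_on linear_conv_bounded_linear[THEN iffD1])
  moreover have "0 \<notin> ?B" using ker by fastforce
  ultimately have "closed (insert 0 (conic hull ?B))" by (simp add: closed_conic_hull)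
  moreover have "T ` N = insert 0 (conic hull ?B)"
  proof (intro equalityI subsetI)
    fix u assume "u \<in> T ` N"
    then obtain X where X: "X \<in> N" "u = T X" by blast
    show "u \<in> insert 0 (conic hull ?B)"
    proof (cases "X = 0")
      case True
      then show ?thesis using X linear_0[OF \<open>linear T\<close>] by simp
    next
      case False
      let ?X = "(1 / norm X) *\<^sub>R X"
      have "?X \<in> N \<inter> sphere 0 1"
        using False X(1) \<open>conic N\<close> by (simp add: conic_def)
      moreover have "u = norm X *\<^sub>R T ?X"
        using False X(2) by (simp add: linear_cmul[OF \<open>linear T\<close>])
      ultimately show ?thesis unfolding conic_hull_explicit by (auto intro!: exI[of _ "norm X"])
    qed
  next
    fix u assume "u \<in> insert 0 (conic hull ?B)"
    then consider "u = 0" | c X where "0 \<le> c" "X \<in> N" "u = c *\<^sub>R T X"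
      unfolding conic_hull_explicit by auto
    then show "u \<in> T ` N"
    proof cases
      case 1
      then show ?thesis using \<open>0 \<in> N\<close> linear_0[OF \<open>linear T\<close>] by force
    next
      case 2
      then have "u = T (c *\<^sub>R X)" "c *\<^sub>R X \<in> N"
        using \<open>conic N\<close> by (auto simp: linear_cmul[OF \<open>linear T\<close>] conic_def)
      then show ?thesis by blast
    qed
  qed
  ultimately show ?thesis by simp
qed

text \<open>There is no Lagrangian duality gap in the problem of minimizing \<open>f y\<close> over \<open>y \<in> K\<close> and
  \<open>X \<in> N\<close> with \<open>G y + T X = c\<close>. Let \<open>S\<close> consist of the pairs of an upper bound on the cost of some
  \<open>(y, X)\<close> and the residual of its constraint. It is convex like \<open>f\<close>, and it is closed because \<open>K\<close> is compact and
  the image of the cone is closed. That \<open>M\<close> is below all feasible costs means that \<open>(M, 0)\<close> is not in \<open>S\<close>,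
  so a hyperplane separates them strictly; its normal vector gives the multiplier.\<close>

lemma conic_strong_duality:
  fixes f :: "'a::euclidean_space \<Rightarrow> real" and G :: "'a \<Rightarrow> 'c::euclidean_space"
    and T :: "'b::euclidean_space \<Rightarrow> 'c"
  assumes K: "compact K" "convex K" "K \<noteq> {}"
    and f: "convex_on K f" "continuous_on K f"
    and "linear G" "linear T"
    and N: "closed N" "convex N" "conic N" "0 \<in> N"
    and ker: "\<And>X. X \<in> N \<Longrightarrow> T X = 0 \<Longrightarrow> X = 0"
    and bound: "\<And>y X. y \<in> K \<Longrightarrow> X \<in> N \<Longrightarrow> G y + T X = c \<Longrightarrow> M < f y"
  obtains \<mu> where "\<And>X. X \<in> N \<Longrightarrow> 0 \<le> \<mu> \<bullet> T X" "\<And>y. y \<in> K \<Longrightarrow> M \<le> f y + \<mu> \<bullet> (G y - c)"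
proof -
  define S where "S = {(s, u). \<exists>y\<in>K. \<exists>X\<in>N. f y \<le> s \<and> u = G y - c + T X}"
  have "closed S"
  proof -
    let ?h = "\<lambda>y. (f y, G y - c)"
    have "compact (?h ` K)"
      using K f linear_continuous_on[OF linear_conv_bounded_linear[THEN iffD1, OF \<open>linear G\<close>]]
      by (intro compact_continuous_image continuous_on_Pair continuous_on_diff continuous_on_const)
    moreover have "closed ({0 :: real..} \<times> T ` N)"
      using N \<open>linear T\<close> ker by (intro closed_Times closed_linear_image_cone closed_atLeast) auto
    ultimately have "closed (\<Union>a\<in>?h ` K. \<Union>b\<in>{0..} \<times> T ` N. {a + b})"
      by (rule compact_closed_sums)
    moreover have "(\<Union>a\<in>?h ` K. \<Union>b\<in>{0..} \<times> T ` N. {a + b}) = S"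
    proof (intro equalityI subsetI)
      fix p assume "p \<in> S"
      then obtain y X s where "y \<in> K" "X \<in> N" "f y \<le> s" "p = (s, G y - c + T X)"
        by (auto simp: S_def)
      then have "p = ?h y + (s - f y, T X)" "(s - f y, T X) \<in> {0..} \<times> T ` N" by auto
      then show "p \<in> (\<Union>a\<in>?h ` K. \<Union>b\<in>{0..} \<times> T ` N. {a + b})"
        using \<open>y \<in> K\<close> by blast
    next
      fix p assume "p \<in> (\<Union>a\<in>?h ` K. \<Union>b\<in>{0..} \<times> T ` N. {a + b})"
      then obtain y t X where "y \<in> K" "0 \<le> t" "X \<in> N" "p = (f y + t, G y - c + T X)" by auto
      moreover from this have "f y \<le> f y + t" by simp
      ultimately show "p \<in> S" unfolding S_def by blast
    qed
    ultimately show ?thesis by simp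
  qed
  moreover have "convex S"
  proof (rule convexI)
    fix p q and a b :: real
    assume pq: "p \<in> S" "q \<in> S" and ab: "0 \<le> a" "0 \<le> b" "a + b = 1"
    obtain y X s where y: "y \<in> K" "X \<in> N" "f y \<le> s" "p = (s, G y - c + T X)"
      using pq by (auto simp: S_def)
    obtain y' X' s' where y': "y' \<in> K" "X' \<in> N" "f y' \<le> s'" "q = (s', G y' - c + T X')"
      using pq by (auto simp: S_def)
    let ?y = "a *\<^sub>R y + b *\<^sub>R y'" and ?X = "a *\<^sub>R X + b *\<^sub>R X'"
    have "?y \<in> K" "?X \<in> N" using K N y y' ab by (auto simp: convex_def)
    moreover have "f ?y \<le> a * s + b * s'"
    proof -
      have "f ?y \<le> a * f y + b * f y'" using f(1) y y' ab by (auto simp: convex_on_def)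
      also have "\<dots> \<le> a * s + b * s'"
        using y y' ab by (intro add_mono mult_left_mono) auto
      finally show ?thesis .
    qed
    moreover have "a *\<^sub>R (G y - c + T X) + b *\<^sub>R (G y' - c + T X') = G ?y - c + T ?X"
    proof -
      have "a *\<^sub>R c + b *\<^sub>R c = c" using ab by (simp flip: scaleR_add_left)
      then show ?thesis
        by (simp add: linear_add[OF \<open>linear G\<close>] linear_cmul[OF \<open>linear G\<close>]
            linear_add[OF \<open>linear T\<close>] linear_cmul[OF \<open>linear T\<close>] algebra_simps)
    qed
    ultimately show "a *\<^sub>R p + b *\<^sub>R q \<in> S" using y(4) y'(4) by (auto simp: S_def)
  qed
  moreover have "(M, 0) \<notin> S"
  proof
    assume "(M, 0) \<in> S"
    then obtain y X where "y \<in> K" "X \<in> N" "f y \<le> M" "0 = G y - c + T X" by (auto simp: S_def)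
    then show False using bound[of y X] by (simp add: algebra_simps)
  qed
  ultimately obtain p \<beta> where "p \<bullet> (M, 0) < \<beta>" and "\<forall>q\<in>S. \<beta> < p \<bullet> q"
    using separating_hyperplane_closed_point by metis
  moreover obtain \<tau> \<nu> where "p = (\<tau>, \<nu>)" by (cases p)
  ultimately have M: "\<tau> * M < \<beta>"
    and sep: "(s, u) \<in> S \<Longrightarrow> \<beta> < \<tau> * s + \<nu> \<bullet> u" for s u
    by auto
  have sep': "\<beta> < \<tau> * s + \<nu> \<bullet> (G y - c) + \<nu> \<bullet> T X"
    if "y \<in> K" "X \<in> N" "f y \<le> s" for y X s
  proof -
    have "(s, G y - c + T X) \<in> S" unfolding S_def using that by blast
    from sep[OF this] show ?thesis by (simp add: inner_add_right add.assoc)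
  qed
  obtain y0 where y0: "y0 \<in> K" using K by blast
  have T0: "T 0 = 0" by (rule linear_0[OF \<open>linear T\<close>])
  \<comment> \<open>The cost bound and the cone are unbounded directions of \<open>S\<close>.\<close>
  have "0 \<le> \<tau>"
  proof (rule ccontr)
    assume neg: "\<not> 0 \<le> \<tau>"
    let ?d = "\<tau> * f y0 + \<nu> \<bullet> (G y0 - c) - \<beta>"
    have "0 < ?d + \<tau> * t" if "0 \<le> t" for t
      using sep'[of y0 0 "f y0 + t"] y0 \<open>0 \<in> N\<close> T0 that by (simp add: algebra_simps)
    from this[of "\<bar>?d\<bar> / (- \<tau>)"] show False using neg by (simp add: field_simps)
  qed
  have cone: "0 \<le> \<nu> \<bullet> T X" if "X \<in> N" for X
  proof (rule ccontr)
    assume neg: "\<not> 0 \<le> \<nu> \<bullet> T X"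
    let ?d = "\<tau> * f y0 + \<nu> \<bullet> (G y0 - c) - \<beta>"
    have "0 < ?d + t * (\<nu> \<bullet> T X)" if "0 \<le> t" for t
      using sep'[of y0 "t *\<^sub>R X" "f y0"] y0 \<open>conic N\<close> \<open>X \<in> N\<close> that
      by (simp add: linear_cmul[OF \<open>linear T\<close>] conic_def)
    from this[of "\<bar>?d\<bar> / (- (\<nu> \<bullet> T X))"] show False using neg by (simp add: field_simps)
  qed
  have base: "\<tau> * M < \<tau> * f y + \<nu> \<bullet> (G y - c)" "\<beta> < \<tau> * f y + \<nu> \<bullet> (G y - c)" if "y \<in> K" for y
    using sep'[OF that \<open>0 \<in> N\<close> order_refl] M T0 by auto
  show ?thesis
  proof (cases "\<tau> = 0")
    case False
    with \<open>0 \<le> \<tau>\<close> have \<tau>: "0 < \<tau>" by simp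
    show ?thesis
    proof (rule that[of "(1 / \<tau>) *\<^sub>R \<nu>"])
      show "0 \<le> ((1 / \<tau>) *\<^sub>R \<nu>) \<bullet> T X" if "X \<in> N" for X
        using cone[OF that] \<tau> by simp
      show "M \<le> f y + ((1 / \<tau>) *\<^sub>R \<nu>) \<bullet> (G y - c)" if "y \<in> K" for y
        using base(1)[OF that] \<tau> by (simp add: field_simps)
    qed
  next
    \<comment> \<open>A separating hyperplane parallel to the cost axis proves infeasibility: the multiplier can be
      scaled until it compensates the least cost on \<open>K\<close>.\<close>
    case True
    then have \<beta>: "0 < \<beta>" using M by simp
    obtain L where L: "\<And>y. y \<in> K \<Longrightarrow> L \<le> f y"
      using continuous_attains_inf[OF K(1,3) f(2)] by metis
    define k where "k = \<bar>M - L\<bar> / \<beta>"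
    have k: "0 \<le> k" "M - L \<le> k * \<beta>" using \<beta> by (auto simp: k_def)
    show ?thesis
    proof (rule that[of "k *\<^sub>R \<nu>"])
      show "0 \<le> (k *\<^sub>R \<nu>) \<bullet> T X" if "X \<in> N" for X
        using cone[OF that] k by simp
      show "M \<le> f y + (k *\<^sub>R \<nu>) \<bullet> (G y - c)" if "y \<in> K" for y
      proof -
        have "k * \<beta> \<le> k * (\<nu> \<bullet> (G y - c))"
          using base(2)[OF that] True k by (intro mult_left_mono) auto
        then show ?thesis using L[OF that] k by simp
      qed
    qed
  qed
qed

section \<open>The Lagrangian of the rank relaxation\<close>

lemma sum_UNIV_Plus:
  fixes g :: "('a::finite) + ('b::finite) \<Rightarrow> 'c::comm_monoid_add"
  shows "(\<Sum>s\<in>UNIV. g s) = (\<Sum>i\<in>UNIV. g (Inl i)) + (\<Sum>i\<in>UNIV. g (Inr i))"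
  unfolding UNIV_Plus_UNIV[symmetric] by (subst sum.Plus) (auto simp: comp_def)

definition diag_vec :: "real^'k^'k \<Rightarrow> real^'k" where
  "diag_vec X = (\<chi> s. X $ s $ s)"

definition node_sums :: "real^('n + 'n) \<Rightarrow> real^'n" where
  "node_sums z = (\<chi> i. z $ Inl i + z $ Inr i)"

lemma inner_dup: "dup \<gamma> \<bullet> z = \<gamma> \<bullet> node_sums z"
  for \<gamma> :: "real^'n::finite"
  by (simp add: dup_def node_sums_def inner_vec_def sum_UNIV_Plus distrib_left sum.distrib)

lemma frob_diag: "frob (diag w) X = w \<bullet> diag_vec X"
  by (simp add: frob_eq diag_def diag_vec_def inner_vec_def if_distrib[of "\<lambda>a. a * _"] cong: if_cong)

definition gen_cost :: "('n::finite) opf_data \<Rightarrow> real^('n + 'n) \<Rightarrow> real" where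
  "gen_cost D y = (\<Sum>i\<in>gens D. Ccost D $ i $ i * (y $ Inl i)\<^sup>2 + ccost D $ i * y $ Inl i)"

definition balance_part :: "('n::finite) opf_data \<Rightarrow> real^('n + 'n)^('n + 'n) \<Rightarrow> real^('n + 'n)" where
  "balance_part D X = (\<chi> r. frob (Amat D r) X)"

definition gen_part :: "('n::finite) opf_data \<Rightarrow> real^('n + 'n) \<Rightarrow> real^('n + 'n)" where
  "gen_part D y = (\<chi> r. avec D r \<bullet> y)"

definition load :: "('n::finite) opf_data \<Rightarrow> real^('n + 'n)" where
  "load D = (\<chi> r. bval D r)"

text \<open>Pairing the multipliers with the part of the constraints that is linear in \<open>X\<close>.\<close>

lemma frob_Lmat:
  "frob (Lmat D \<phi> (dup \<gamma>)) X = \<phi> \<bullet> balance_part D X + \<gamma> \<bullet> node_sums (diag_vec X)"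
proof -
  have "frob (\<Sum>r\<in>UNIV. \<phi> $ r *\<^sub>R Amat D r) X = (\<Sum>r\<in>UNIV. \<phi> $ r * frob (Amat D r) X)"
    by (simp add: frob_commute[of _ X] linear_sum[OF linear_frob] linear_cmul[OF linear_frob])
  then show ?thesis
    by (simp add: Lmat_def frob_add frob_diag inner_dup balance_part_def inner_vec_def[of \<phi>])
qed

lemma sym_matrix_Lmat: "sym_matrix (Lmat D \<phi> \<gamma>')"
proof -
  have "Amat D r $ s $ t = Amat D r $ t $ s" for r s t
    using sym_matrix_Amat[of D r] by (simp add: sym_matrix_entry)
  then show ?thesis by (auto simp: sym_matrix_entry Lmat_def diag_def)
qed

text \<open>The condition on the multipliers in its conic form: the cone of positive semidefinite matrices is
  self-dual, and the matrices \<open>outer v\<close> suffice to test membership in the dual.\<close>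

lemma psd_Lmat_iff: "psd (Lmat D \<phi> \<gamma>') \<longleftrightarrow> (\<forall>X. psd X \<longrightarrow> 0 \<le> frob (Lmat D \<phi> \<gamma>') X)"
  using frob_psd_nonneg psd_outer sym_matrix_Lmat by (metis frob_outer psd_def)

text \<open>The objective of the convex relaxation is a Lagrangian: the multiplier \<open>\<gamma>\<close>, repeated for both
  coordinates of a node, only sees the sums of \<open>z\<close> over the nodes.\<close>

lemma hobj_eq:
  "hobj D \<phi> (dup \<gamma>) x y z =
     gen_cost D y + frob (Lmat D \<phi> (dup \<gamma>)) (outer x) + \<phi> \<bullet> (gen_part D y - load D) - \<gamma> \<bullet> node_sums z"
  by (simp add: hobj_def gen_cost_def inner_dup gen_part_def load_def inner_vec_def[of \<phi>])

lemma Ccost_nonneg: "opf_network D \<Longrightarrow> 0 \<le> Ccost D $ i $ i"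
  by (simp add: opf_network_def psd_diag_nonneg)

lemma psd_bordered_square_le:
  assumes "psd (bordered y Y)"
  shows "(y $ k)\<^sup>2 \<le> Y $ k $ k"
  using psd_entry_square_le[OF assms, of None "Some k"] by (simp add: bordered_def)

lemma psd_bordered_outer: "psd (bordered y (outer y))"
proof -
  have "bordered y (outer y) = outer (\<chi> s. case s of None \<Rightarrow> 1 | Some k \<Rightarrow> y $ k)"
    by (auto simp: vec_eq_iff bordered_def outer_def split: option.splits)
  then show ?thesis by (simp add: psd_outer)
qed

section \<open>Weak duality\<close>

text \<open>With \<open>x = 0\<close> and \<open>z\<close> the diagonal of \<open>X\<close>, the quadratic constraint for \<open>A\<close> becomes
  \<open>\<lambda>\<^sub>m\<^sub>i\<^sub>n(A) trace X \<le> \<langle>A, X\<rangle>\<close>. The linear upper bound on \<open>z\<close> becomes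
  \<open>X\<^sub>s\<^sub>,\<^sub>s \<le> u\<^sub>s\<^sup>2\<close>, the voltage bound of the node after dropping the other, nonnegative, diagonal entry.\<close>

lemma OPF_feasible_of_SDP_feasible:
  fixes D :: "('n::finite) opf_data"
  assumes D: "opf_network D" and "(y, Y, X) \<in> SDP_feasible D"
  shows "(0, y, diag_vec X) \<in> OPF_feasible D"
proof -
  have X: "psd X" "gen_vec D y" "gen_bounds D y"
    and bal: "\<And>r. frob (Amat D r) X + avec D r \<bullet> y = bval D r"
    and volt: "\<And>i. vlo D $ i \<le> X $ Inl i $ Inl i + X $ Inr i $ Inr i"
      "\<And>i. X $ Inl i $ Inl i + X $ Inr i $ Inr i \<le> vup D $ i"
    using assms(2) by (auto simp: SDP_feasible_def)
  have diag0: "0 \<le> X $ s $ s" for s by (rule psd_diag_nonneg[OF X(1)])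
  have outer0: "frob M (outer 0) = 0" for M :: "real^('n + 'n)^('n + 'n)" by (simp add: frob_outer)
  have "lambda_min (Amat D r) * (\<Sum>s\<in>UNIV. X $ s $ s) \<le> frob (Amat D r) X" for r
    by (rule lambda_min_trace_le[OF sym_matrix_Amat X(1)])
  moreover have "lambda_min (- Amat D r) * (\<Sum>s\<in>UNIV. X $ s $ s) \<le> - frob (Amat D r) X" for r
  proof -
    have "sym_matrix (- Amat D r)" using sym_matrix_Amat[of D r] by (simp add: sym_matrix_entry)
    moreover have "frob (- Amat D r) X = - frob (Amat D r) X" using frob_scale[of "-1"] by simp
    ultimately show ?thesis using lambda_min_trace_le[of "- Amat D r" X] X(1) by simp
  qed
  moreover have "X $ s $ s \<le> ubound D $ s * ubound D $ s" for s
  proof (cases s)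
    case (Inl i)
    have "0 \<le> vup D $ i" using D by (simp add: opf_network_def)
    then show ?thesis using Inl volt(2)[of i] diag0[of "Inr i"] by (simp add: ubound_def dup_def)
  next
    case (Inr i)
    have "0 \<le> vup D $ i" using D by (simp add: opf_network_def)
    then show ?thesis using Inr volt(2)[of i] diag0[of "Inl i"] by (simp add: ubound_def dup_def)
  qed
  ultimately show ?thesis
    using X volt diag0 bal[symmetric]
    by (simp add: OPF_feasible_def diag_vec_def outer0 lbound_def sum_negf)
qed

lemma P_value_le_SDP_value:
  assumes D: "opf_network D"
  shows "P_value D \<le> SDP_value D"
proof -
  have "OPF_value D \<phi> (dup \<gamma>) \<le>
      ereal (\<Sum>i\<in>gens D. Ccost D $ i $ i * Y $ Inl i $ Inl i + ccost D $ i * y $ Inl i)"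
    if L: "psd (Lmat D \<phi> (dup \<gamma>))" and feas: "(y, Y, X) \<in> SDP_feasible D" for \<phi> \<gamma> y Y X
  proof -
    have "gen_part D y - load D = - balance_part D X"
      using feas by (auto simp: SDP_feasible_def gen_part_def load_def balance_part_def vec_eq_iff
          algebra_simps dest!: spec)
    then have "hobj D \<phi> (dup \<gamma>) 0 y (diag_vec X) = gen_cost D y - frob (Lmat D \<phi> (dup \<gamma>)) X"
      by (simp add: hobj_eq frob_outer frob_Lmat[of D \<phi> \<gamma> X])
    also have "\<dots> \<le> gen_cost D y"
      using frob_psd_nonneg[OF L] feas by (simp add: SDP_feasible_def)
    also have "\<dots> \<le> (\<Sum>i\<in>gens D. Ccost D $ i $ i * Y $ Inl i $ Inl i + ccost D $ i * y $ Inl i)"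
      unfolding gen_cost_def using feas Ccost_nonneg[OF D]
      by (auto simp: SDP_feasible_def intro!: sum_mono mult_left_mono psd_bordered_square_le)
    finally show ?thesis
      unfolding OPF_value_def
      by (intro INF_lower2[OF OPF_feasible_of_SDP_feasible[OF D feas]]) simp
  qed
  then show ?thesis
    unfolding P_value_def SDP_value_def by (intro SUP_least INF_greatest) auto
qed

section \<open>Strong duality\<close>

lemma gen_set_eq_cbox:
  "{y. gen_vec D y \<and> gen_bounds D y} =
    cbox (\<chi> s. if s \<in> gens D <+> gens D then case s of Inl i \<Rightarrow> plo D $ i | Inr i \<Rightarrow> qlo D $ i else 0)
         (\<chi> s. if s \<in> gens D <+> gens D then case s of Inl i \<Rightarrow> pup D $ i | Inr i \<Rightarrow> qup D $ i else 0)"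
    (is "?A = cbox ?l ?u")
proof (rule set_eqI)
  fix y :: "real^('a + 'a)"
  have gens: "Inl i \<in> gens D <+> gens D \<longleftrightarrow> i \<in> gens D" "Inr i \<in> gens D <+> gens D \<longleftrightarrow> i \<in> gens D" for i
    by auto
  have coord: "(if b then l else 0) \<le> t \<and> t \<le> (if b then u else 0) \<longleftrightarrow>
      (\<not> b \<longrightarrow> t = 0) \<and> (b \<longrightarrow> l \<le> t \<and> t \<le> u)" for b and l t u :: real
    by auto
  have "y \<in> cbox ?l ?u \<longleftrightarrow> (\<forall>s. ?l $ s \<le> y $ s \<and> y $ s \<le> ?u $ s)" by (simp add: mem_box_cart)
  also have "\<dots> \<longleftrightarrow> gen_vec D y \<and> gen_bounds D y"
    unfolding gen_vec_def gen_bounds_def split_sum_all vec_lambda_beta gens sum.case coord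
    by blast
  finally show "y \<in> ?A \<longleftrightarrow> y \<in> cbox ?l ?u" by simp
qed

lemma convex_on_gen_cost:
  assumes "opf_network D"
  shows "convex_on UNIV (gen_cost D)"
proof -
  have "convex_on UNIV (\<lambda>y :: real^('a + 'a). (y $ s)\<^sup>2)" for s
    using convex_power2 by (auto simp: convex_on_def)
  moreover have "convex_on UNIV (\<lambda>y :: real^('a + 'a). c * y $ s)" for c s
    by (auto simp: convex_on_def algebra_simps)
  ultimately have summand: "convex_on UNIV
      (\<lambda>y :: real^('a + 'a). Ccost D $ i $ i * (y $ Inl i)\<^sup>2 + ccost D $ i * y $ Inl i)" for i
    by (intro convex_on_add convex_on_cmul[OF Ccost_nonneg[OF assms]])
  have "convex_on UNIV (\<lambda>y :: real^('a + 'a).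
      \<Sum>i\<in>I. Ccost D $ i $ i * (y $ Inl i)\<^sup>2 + ccost D $ i * y $ Inl i)" for I
    by (induction I rule: infinite_finite_induct) (use summand in \<open>auto simp: convex_on_const\<close>)
  then show ?thesis by (simp add: gen_cost_def[abs_def])
qed

text \<open>Strong duality, applied to the conic program in \<open>(y, w)\<close> and \<open>X\<close>. The cone constraint on the
  multipliers says that \<open>Lmat\<close> is positive semidefinite, and the lower bound \<open>M\<close> on the Lagrangian over
  the boxes carries over to every feasible point of the convex relaxation.\<close>

lemma dual_multipliers:
  fixes D :: "('n::finite) opf_data"
  assumes D: "opf_network D" and M: "ereal M < SDP_value D" and ne: "OPF_feasible D \<noteq> {}"
  obtains \<phi> \<gamma> where "psd (Lmat D \<phi> (dup \<gamma>))" "ereal M \<le> OPF_value D \<phi> (dup \<gamma>)"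
proof -
  let ?K = "{y. gen_vec D y \<and> gen_bounds D y} \<times> cbox (vlo D) (vup D)"
  let ?N = "{X :: real^('n + 'n)^('n + 'n). psd X}"
  let ?f = "\<lambda>p :: (real^('n + 'n)) \<times> (real^'n). gen_cost D (fst p)"
  let ?G = "\<lambda>p :: (real^('n + 'n)) \<times> (real^'n). (gen_part D (fst p), - snd p)"
  let ?T = "\<lambda>X. (balance_part D X, node_sums (diag_vec X))"
  have K: "compact ?K" "convex ?K"
    unfolding gen_set_eq_cbox by (auto intro!: compact_Times convex_Times)
  have feas: "(y, node_sums z) \<in> ?K" if "(x, y, z) \<in> OPF_feasible D" for x y z
    using that by (auto simp: OPF_feasible_def mem_box_cart node_sums_def)
  have "?K \<noteq> {}" using ne feas by fast
  have f: "convex_on ?K ?f"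
    using convex_on_gen_cost[OF D] K(2) by (simp add: convex_on_def)
  have f_cont: "continuous_on ?K ?f"
    unfolding gen_cost_def by (intro continuous_intros)
  have G: "linear ?G"
    by (intro linearI) (auto simp: gen_part_def vec_eq_iff inner_add_right)
  have T: "linear ?T"
    by (intro linearI) (auto simp: balance_part_def node_sums_def diag_vec_def vec_eq_iff
        linear_add[OF linear_frob] linear_cmul[OF linear_frob] algebra_simps)
  \<comment> \<open>The node sums determine the trace, and a positive semidefinite matrix with trace 0 vanishes.\<close>
  have ker: "X = 0" if "X \<in> ?N" "?T X = 0" for X
  proof -
    have sum0: "X $ Inl i $ Inl i + X $ Inr i $ Inr i = 0" for i
      using that(2) by (simp add: node_sums_def diag_vec_def vec_eq_iff zero_prod_def)
    have nonneg: "0 \<le> X $ s $ s" for s using that(1) by (simp add: psd_diag_nonneg)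
    have "X $ s $ s = 0" for s
      using sum0 nonneg by (cases s) (metis add_nonneg_eq_0_iff)+
    then have "(X $ s $ t)\<^sup>2 \<le> 0" for s t using psd_entry_square_le[of X s t] that(1) by simp
    then show ?thesis by (simp add: vec_eq_iff)
  qed
  have lower: "M < ?f p" if "p \<in> ?K" "X \<in> ?N" "?G p + ?T X = (load D, 0)" for p X
  proof -
    obtain y w where p: "p = (y, w)" by (cases p)
    have "frob (Amat D r) X + avec D r \<bullet> y = bval D r" for r
      using that(3) p by (simp add: balance_part_def gen_part_def load_def vec_eq_iff add.commute)
    moreover have "w = node_sums (diag_vec X)" using that(3) p by simp
    moreover have "gen_mat D (outer y)"
      using that(1) p by (auto simp: gen_mat_def gen_vec_def outer_def)
    ultimately have "(y, outer y, X) \<in> SDP_feasible D"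
      using that(1,2) p psd_bordered_outer[of y] psd_outer[of y]
      by (auto simp: SDP_feasible_def psd_def[of X] psd_def[of "outer y"] mem_box_cart
          node_sums_def diag_vec_def)
    then have "SDP_value D \<le> ereal (gen_cost D y)"
      unfolding SDP_value_def
      by (rule INF_lower2) (simp add: gen_cost_def outer_def power2_eq_square)
    then have "ereal M < ereal (gen_cost D y)" using M by (rule less_le_trans[rotated])
    then show ?thesis using p by simp
  qed
  have "0 \<in> ?N" by (simp add: psd_zero)
  obtain \<mu> where cone: "\<And>X. X \<in> ?N \<Longrightarrow> 0 \<le> \<mu> \<bullet> ?T X"
    and bound: "\<And>p. p \<in> ?K \<Longrightarrow> M \<le> ?f p + \<mu> \<bullet> (?G p - (load D, 0))"
    by (rule conic_strong_duality[OF K \<open>?K \<noteq> {}\<close> f f_cont G T closed_psd convex_psd conic_psd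
        \<open>0 \<in> ?N\<close>, of "(load D, 0)" M]) (use ker lower in blast)+
  obtain \<phi> \<gamma> where \<mu>: "\<mu> = (\<phi>, \<gamma>)" by (cases \<mu>)
  have L: "psd (Lmat D \<phi> (dup \<gamma>))"
    unfolding psd_Lmat_iff frob_Lmat using cone \<mu> by simp
  have "M \<le> hobj D \<phi> (dup \<gamma>) x y z" if "(x, y, z) \<in> OPF_feasible D" for x y z
    using bound[OF feas[OF that]] \<mu> frob_psd_nonneg[OF L psd_outer[of x]] by (simp add: hobj_eq)
  then have "ereal M \<le> OPF_value D \<phi> (dup \<gamma>)"
    unfolding OPF_value_def by (intro INF_greatest) auto
  with L show ?thesis by (rule that)
qed

lemma SDP_value_le_P_value:
  assumes "opf_network D"
  shows "SDP_value D \<le> P_value D"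
proof (rule dense_le)
  fix m assume "m < SDP_value D"
  then obtain M where M: "m < ereal M" "ereal M < SDP_value D" using ereal_dense2 by blast
  have P: "OPF_value D \<phi> (dup \<gamma>) \<le> P_value D" if "psd (Lmat D \<phi> (dup \<gamma>))" for \<phi> \<gamma>
    unfolding P_value_def using that by (intro SUP_upper2[of "(\<phi>, \<gamma>)"]) auto
  have "ereal M \<le> P_value D"
  proof (cases "OPF_feasible D = {}")
    \<comment> \<open>Feasibility does not involve the multipliers; the value is \<open>\<infinity>\<close> at 0, which is admissible.\<close>
    case True
    have "psd (Lmat D 0 (dup 0))"
      unfolding psd_Lmat_iff frob_Lmat by simp
    from P[OF this] True show ?thesis by (simp add: OPF_value_def top_ereal_def)
  next
    case False
    then obtain \<phi> \<gamma> where "psd (Lmat D \<phi> (dup \<gamma>))" "ereal M \<le> OPF_value D \<phi> (dup \<gamma>)"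
      using dual_multipliers[OF assms M(2)] by blast
    with P show ?thesis by (blast intro: order_trans)
  qed
  with M(1) show "m \<le> P_value D" by (simp add: less_imp_le order_trans[of m "ereal M"])
qed

theorem theorem1:
  fixes D :: "('n::finite) opf_data"
  assumes "opf_network D"
  shows "P_value D = SDP_value D"
  by (rule antisym[OF P_value_le_SDP_value[OF assms] SDP_value_le_P_value[OF assms]])

end
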